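(* Let $r>s>1$ and $s/r<\alpha\le 1$. Let $\mathbf u=(u_n)_{n\ge1}$, $\mathbf v=(v_n)_{n\ge1}$, $\mathbf a=(a_n)_{n\ge1}$ be sequences with positive entries, and let $V_n=\sum_{k=1}^n v_k$ for $n\ge1$, $V_0=0$. Suppose that for every $m\ge 1$ $$\sum_{n=1}^m u_nV_n^{\alpha r}\le V_m^s .$$ Then $$\sum_{n=1}^\infty u_n\Big(\sum_{k=1}^n\big(V_k^{\alpha}-V_{k-1}^{\alpha}\big)a_k\Big)^{r}\ \le\ s\,\alpha^r K\Big(\sum_{n=1}^\infty v_na_n^{r/s}\Big)^{s},$$ where $$K=\frac{1}{(r-s)\Big(1+(\alpha-1)\frac{r}{r-s}\Big)^{r-s+1}}\left(\frac{(s-1)\,\Gamma\!\big(\tfrac{r}{s-1}\big)}{\Gamma\!\big(\tfrac{1}{s-1}\big)\,\Gamma\!\big(\tfrac{r-1}{s-1}\big)}\right)^{s-1}.$$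
   Context: $\Gamma$ is the Gamma function. Infinite sums are assumed to converge. *)

theory Defs
  imports "HOL-Analysis.Analysis"
begin

(* At \<alpha> = 1 this is the sharp constant of Bliss's integral inequality with exponents
   p = r / s and q = r. *)
definition bliss_const :: "real \<Rightarrow> real \<Rightarrow> real \<Rightarrow> real" where
  "bliss_const r s \<alpha> =
     1 / ((r - s) * (1 + (\<alpha> - 1) * (r / (r - s))) powr (r - s + 1)) *
     ((s - 1) * Gamma (r / (s - 1)) /
        (Gamma (1 / (s - 1)) * Gamma ((r - 1) / (s - 1)))) powr (s - 1)"

end

theory Submission imports Defs
begin

text \<open>Regard \<open>a\<close> as a step function \<open>f\<close> of \<open>t\<close> with breakpoints \<open>V\<^sub>k\<close>. Replacing \<open>a\<close> by its level
  sequence with respect to the weights \<open>V\<^sub>k powr \<alpha> - V\<^sub>k\<^sub>-\<^sub>1 powr \<alpha>\<close> makes \<open>f\<close> decreasing, enlarges its primitive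
  and, since \<open>\<alpha> \<le> 1\<close>, does not enlarge its energy. For decreasing \<open>f\<close> the averages are decreasing,
  so Abel summation replaces the weights \<open>u\<^sub>n V\<^sub>n powr (\<alpha> r)\<close> by \<open>V\<^sub>n powr s - V\<^sub>n\<^sub>-\<^sub>1 powr s\<close>, which reduces
  the claim to a weighted Bliss inequality for \<open>f\<close>.

  The latter is proved by transport of energy. With \<open>F\<close> the integral of \<open>t powr (\<alpha> - 1) * f t\<close> and
  \<open>E\<close> the integral of \<open>f powr (r / s)\<close>, let \<open>w t\<close> be the point up to which the extremal function
  has used the same fraction of its energy as \<open>f\<close> has up to \<open>t\<close>; in a suitable coordinate on
  \<open>(0, 1)\<close> the energy of the extremal is an incomplete beta integral. Then
  \<open>c * E t - F t powr r * t powr (s - \<alpha> r) / w t\<close> has derivative at least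
  \<open>(\<alpha> r - s) * F t powr r * t powr (s - \<alpha> r - 1)\<close>, by Bernoulli's inequality and the weighted
  AM-GM inequality.\<close>

section \<open>Tangent, Bernoulli and AM-GM inequalities\<close>

lemma powr_above_tangent:
  fixes x c p :: real
  assumes "1 \<le> p" "0 \<le> x" "0 < c"
  shows "c powr p + p * c powr (p - 1) * (x - c) \<le> x powr p"
\<comment> \<open>The tangent argument runs on \<open>{0<..}\<close>, so the endpoint 0 is checked
  directly.\<close>
proof (cases "x = 0")
  case True
  have "c powr p = c * c powr (p - 1)"
    using assms by (simp add: powr_mult_base)
  then have "c powr p + p * c powr (p - 1) * (x - c) = (1 - p) * c powr p"
    using True by (simp add: algebra_simps)
  also have "\<dots> \<le> 0" using assms by (simp add: mult_nonpos_nonneg)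
  finally show ?thesis using True by simp
next
  case False
  have "p * c powr (p - 1) * (x - c) \<le> x powr p - c powr p"
  proof (rule convex_on_imp_above_tangent[OF powr_convex[OF assms(1)]])
    show "((\<lambda>x. x powr p) has_real_derivative p * c powr (p - 1)) (at c within {0<..})"
      using assms by (auto intro!: derivative_eq_intros)
  qed (use assms False in \<open>auto simp: interior_open\<close>)
  then show ?thesis by simp
qed

lemma bernoulli_powr:
  fixes x p :: real
  assumes "1 \<le> p" "0 \<le> x"
  shows "p * x - (p - 1) \<le> x powr p"
  using powr_above_tangent[of p x 1] assms by (simp add: algebra_simps)

lemma weighted_am_gm:
  fixes A Z D s :: real
  assumes s: "1 < s" and "0 < A" "0 < Z" "0 < D"
  shows "s * A powr (1 / s) * Z powr ((s - 1) / s) \<le> A * D powr (s - 1) + (s - 1) * Z / D"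
proof -
  \<comment> \<open>\<open>y\<close> compares \<open>D\<close> with the minimizer
    \<open>(Z / A) powr (1 / s)\<close> of the right-hand side, so Bernoulli is sharp at
    \<open>y = 1\<close>.\<close>
  define y where "y = D * (A / Z) powr (1 / s)"
  have "s * y - (s - 1) \<le> y powr s"
    using assms by (intro bernoulli_powr) (auto simp: y_def)
  also have "y powr s = D powr s * (A / Z)"
    using assms by (simp add: y_def powr_mult powr_powr)
  finally have "Z / D * (s * y - (s - 1)) \<le> Z / D * (D powr s * (A / Z))"
    using assms by (intro mult_left_mono) auto
  moreover have "Z / D * (D powr s * (A / Z)) = A * D powr (s - 1)"
    using assms by (simp add: powr_diff)
  moreover have "Z / D * y = A powr (1 / s) * Z powr ((s - 1) / s)"
    using assms by (simp add: y_def powr_divide diff_divide_distrib powr_diff)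
  moreover have "Z / D * (s * y - (s - 1)) = s * (Z / D * y) - (s - 1) * Z / D"
    by (simp add: algebra_simps diff_divide_distrib add_divide_distrib)
  ultimately show ?thesis
    by (simp add: mult.assoc)
qed

text \<open>The derivative estimate in scale-free form: \<open>h\<close> stands for the logarithmic
  derivative \<open>t * F' / F\<close> of the primitive, and \<open>D\<close> collects the remaining
  scales. AM-GM eliminates \<open>D\<close>; Bernoulli then makes the bound linear in
  \<open>h\<close>.\<close>

lemma transport_pointwise:
  fixes r s th w h D :: real
  assumes s: "1 < s" "s < r" and th: "0 < th" and w: "0 < w" "w < 1" and "0 \<le> h" "0 < D"
  shows "r * h - th * (r - s) * (1 - w) \<le>
    h powr (r / s) * w *
      (th powr (s - r) * D powr (s - 1) +
       (s - 1) / (D * w powr (s / (s - 1)) * (1 - w) powr ((r - 1) / (s - 1) - 1)))"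
proof -
  define p where "p = r / s"
  have p: "1 < p" "r = p * s" using s by (auto simp: p_def field_simps)
  \<comment> \<open>The point of tangency: after AM-GM the lower bound for the right-hand side is
    \<open>s * M * (h / M) powr p\<close>, and Bernoulli is sharp at \<open>h = M\<close>.\<close>
  define M where "M = th * (1 - w)"
  have M: "0 < M" using th w by (simp add: M_def)
  \<comment> \<open>The exponents make \<open>Z powr ((s - 1) / s)\<close> equal to
    \<open>(1 - w) powr (1 - p) / w\<close>, which cancels the prefactor \<open>w\<close>.\<close>
  define Z where "Z = w powr - (s / (s - 1)) * (1 - w) powr (1 - (r - 1) / (s - 1))"
  have Zpos: "0 < Z" using w by (simp add: Z_def)
  have e1: "(th powr (s - r)) powr (1 / s) = th powr (1 - p)"
  proof -
    have "(s - r) * (1 / s) = 1 - p" using s by (simp add: p_def field_simps)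
    then show ?thesis by (simp only: powr_powr)
  qed
  have "Z powr ((s - 1) / s) = w powr -1 * (1 - w) powr ((1 - (r - 1) / (s - 1)) * ((s - 1) / s))"
    using s w by (simp add: Z_def powr_mult powr_powr)
  also have "(1 - (r - 1) / (s - 1)) * ((s - 1) / s) = 1 - p"
    using s by (simp add: p field_simps)
  finally have e2: "Z powr ((s - 1) / s) = (1 - w) powr (1 - p) / w"
    using w by (simp add: powr_minus field_simps)
  have "s * th powr (1 - p) * ((1 - w) powr (1 - p) / w)
      \<le> th powr (s - r) * D powr (s - 1) + (s - 1) * Z / D"
    using weighted_am_gm[of s "th powr (s - r)" Z D] e1 e2 assms Zpos by simp
  then have "h powr p * w * (s * th powr (1 - p) * ((1 - w) powr (1 - p) / w)) \<le>
     h powr p * w * (th powr (s - r) * D powr (s - 1) + (s - 1) * Z / D)"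
    using w by (intro mult_left_mono) auto
  moreover have hM: "(h / M) powr p = h powr p / (th powr p * (1 - w) powr p)"
    using w th assms(6) by (simp add: M_def powr_mult powr_divide)
  moreover have "h powr p * w * (s * th powr (1 - p) * ((1 - w) powr (1 - p) / w)) = s * M * (h / M) powr p"
    using w th unfolding hM by (simp add: M_def powr_diff)
  moreover have "s * M * (p * (h / M) - (p - 1)) \<le> s * M * (h / M) powr p"
    using s M p assms by (intro mult_left_mono bernoulli_powr) auto
  moreover have "s * M * (p * (h / M) - (p - 1)) = r * h - th * (r - s) * (1 - w)"
  proof -
    have "s * M * (p * (h / M) - (p - 1)) = p * s * h - M * (p * s - s)"
      using M by (simp add: field_simps)
    then show ?thesis by (simp add: p(2) M_def)
  qed
  moreover have "(s - 1) * Z / D =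
     (s - 1) / (D * w powr (s / (s - 1)) * (1 - w) powr ((r - 1) / (s - 1) - 1))"
  proof -
    have "1 - (r - 1) / (s - 1) = - ((r - 1) / (s - 1) - 1)" by simp
    then have "Z = inverse (w powr (s / (s - 1))) * inverse ((1 - w) powr ((r - 1) / (s - 1) - 1))"
      by (simp only: Z_def powr_minus)
    then show ?thesis by (simp add: divide_inverse mult_ac)
  qed
  ultimately show ?thesis unfolding p_def by simp
qed

section \<open>Inverse of the incomplete beta integral\<close>

text \<open>The integrand is positive inside \<open>(0, 1)\<close>, so its integral \<open>J\<close>
  increases strictly from 0 to \<open>Beta a b\<close> and has an inverse. \<open>W\<close> turns an
  amount of energy into the coordinate of the extremal. Everything is claimed for interior points
  only, since the integrand may blow up or vanish near the ends.\<close>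

lemma incomplete_beta_inverse:
  fixes a b :: real
  assumes a: "0 < a" and b: "0 < b"
  obtains W :: "real \<Rightarrow> real" where
    "\<And>y. 0 < y \<Longrightarrow> y < Beta a b \<Longrightarrow> 0 < W y \<and> W y < 1"
    "\<And>y. 0 < y \<Longrightarrow> y < Beta a b \<Longrightarrow>
       (W has_real_derivative 1 / (W y powr (a - 1) * (1 - W y) powr (b - 1))) (at y)"
proof -
  define f where "f = (\<lambda>t. t powr (a - 1) * (1 - t) powr (b - 1) :: real)"
  define J where "J w = integral {0..w} f" for w
  have int: "(f has_integral Beta a b) {0..1}"
    unfolding f_def by (rule has_integral_Beta_real[OF a b])
  then have intf: "f integrable_on {0..1}" by blast
  have J0: "J 0 = 0" by (simp add: J_def)
  have J1: "J 1 = Beta a b" using int by (simp add: J_def integral_unique)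
  have cont: "continuous_on {0..1} J"
    unfolding J_def by (rule indefinite_integral_continuous_1[OF intf])
  have der: "(J has_real_derivative f w) (at w)" if w: "0 < w" "w < 1" for w
  proof -
    have "continuous (at w within ({0..1} - {})) f"
      unfolding f_def using w by (intro continuous_intros) auto
    then have "(J has_vector_derivative f w) (at w within ({0..1} - {}))"
      unfolding J_def using w by (intro integral_has_vector_derivative_continuous_at intf) auto
    moreover have "at w within ({0..1} - {}) = at w"
      using w by (intro at_within_interior) auto
    ultimately show ?thesis by (simp add: has_real_derivative_iff_has_vector_derivative)
  qed
  have fpos: "0 < f w" if "0 < w" "w < 1" for w
    using that by (simp add: f_def)
  have mono: "J x < J y" if "0 \<le> x" "x < y" "y \<le> 1" for x y
  proof (rule DERIV_pos_imp_increasing_open[OF that(2)])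
    show "\<exists>d. (J has_real_derivative d) (at z) \<and> 0 < d" if "x < z" "z < y" for z
      using der[of z] fpos[of z] that \<open>0 \<le> x\<close> \<open>y \<le> 1\<close> by (intro exI[of _ "f z"]) auto
    show "continuous_on {x..y} J"
      using cont that by (rule_tac continuous_on_subset) auto
  qed
  have inj: "inj_on J {0..1}"
    by (rule linorder_inj_onI) (use mono in fastforce)+
  define W where "W = the_inv_into {0..1} J"
  have im: "y \<in> J ` {0..1}" if "0 \<le> y" "y \<le> Beta a b" for y
    using IVT'[of J 0 y 1] that cont J0 J1 by auto
  have JW: "J (W y) = y" if "0 \<le> y" "y \<le> Beta a b" for y
    unfolding W_def using f_the_inv_into_f[OF inj im[OF that]] .
  have W01: "W y \<in> {0..1}" if "0 \<le> y" "y \<le> Beta a b" for y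
    unfolding W_def by (rule the_inv_into_into[OF inj im[OF that] order_refl])
  have W: "0 < W y \<and> W y < 1" if y: "0 < y" "y < Beta a b" for y
    using JW[of y] W01[of y] y J0 J1 by (auto simp: less_le)
  \<comment> \<open>A continuous injection of a compact set has a continuous inverse; the inverse
    function rule asks for this continuity.\<close>
  have contW: "continuous_on (J ` {0..1}) W"
    unfolding W_def by (rule continuous_on_inv_into[OF cont _ inj]) simp
  have derW: "(W has_real_derivative 1 / (W y powr (a - 1) * (1 - W y) powr (b - 1))) (at y)"
    if y: "0 < y" "y < Beta a b" for y
  proof -
    have "continuous_on {0<..<Beta a b} W"
      by (rule continuous_on_subset[OF contW]) (use im in auto)
    then have "isCont W y" using y by (simp add: continuous_on_eq_continuous_at)
    then have "(W has_real_derivative inverse (f (W y))) (at y)"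
      using der[of "W y"] W[OF y] fpos[of "W y"] y JW
      by (intro DERIV_inverse_function[where f = J and a = 0 and b = "Beta a b"]) auto
    then show ?thesis by (simp add: f_def divide_inverse)
  qed
  show ?thesis by (rule that[OF W derW])
qed

section \<open>Passage to a decreasing sequence\<close>

text \<open>The tangent at \<open>c\<close> bounds both powers from below. As \<open>c\<close> is
  the mean for the weights \<open>d\<close>, \<open>d'\<close> and the larger value \<open>y\<close>
  carries relatively more of the \<open>v\<close> weight, the linear terms have a nonnegative
  sum.\<close>

lemma powr_merge:
  fixes d d' v v' x y p :: real
  assumes p: "1 \<le> p" and d: "0 < d" "0 < d'" and vd: "v / d \<le> v' / d'" and v: "0 \<le> v" "0 \<le> v'"
    and xy: "0 \<le> x" "x < y"
  defines "c \<equiv> (d * x + d' * y) / (d + d')"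
  shows "v * c powr p + v' * c powr p \<le> v * x powr p + v' * y powr p"
proof -
  have c: "x < c" "c < y" "0 < c" "d * (x - c) + d' * (y - c) = 0"
    using d xy by (auto simp: c_def field_simps intro!: add_nonneg_pos)
  have "v * (x - c) + v' * (y - c) = (v' / d' - v / d) * (d' * (y - c))"
  proof -
    have "v * (x - c) = v / d * (d * (x - c))" "v' * (y - c) = v' / d' * (d' * (y - c))"
      using d by auto
    moreover have "d * (x - c) = - (d' * (y - c))" using c(4) by simp
    ultimately show ?thesis by (simp only:) (simp add: algebra_simps)
  qed
  also have "\<dots> \<ge> 0" using c d vd by simp
  finally have *: "0 \<le> p * c powr (p - 1) * (v * (x - c) + v' * (y - c))"
    using p by (intro mult_nonneg_nonneg) auto
  have "v * (c powr p + p * c powr (p - 1) * (x - c)) \<le> v * x powr p"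
       "v' * (c powr p + p * c powr (p - 1) * (y - c)) \<le> v' * y powr p"
    using v c xy p by (auto intro!: mult_left_mono powr_above_tangent)
  with * show ?thesis by (simp add: algebra_simps)
qed

text \<open>Among the competitors with larger partial sums and no more energy, one maximizing the sum of
  the partial sums cannot increase anywhere: averaging two consecutive entries would improve it.\<close>

lemma level_sequence:
  fixes a d v :: "nat \<Rightarrow> real" and p :: real and N :: nat
  assumes p: "1 \<le> p"
    and d: "\<And>k. 1 \<le> k \<Longrightarrow> 0 < d k" and v: "\<And>k. 1 \<le> k \<Longrightarrow> 0 < v k"
    and vd: "\<And>k. 1 \<le> k \<Longrightarrow> v k / d k \<le> v (Suc k) / d (Suc k)"
    and a: "\<And>k. 1 \<le> k \<Longrightarrow> 0 \<le> a k"
  obtains b :: "nat \<Rightarrow> real" where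
    "\<And>k. 0 \<le> b k"
    "\<And>k. 1 \<le> k \<Longrightarrow> Suc k \<le> N \<Longrightarrow> b (Suc k) \<le> b k"
    "\<And>n. n \<le> N \<Longrightarrow> (\<Sum>k=1..n. d k * a k) \<le> (\<Sum>k=1..n. d k * b k)"
    "(\<Sum>k=1..N. v k * b k powr p) \<le> (\<Sum>k=1..N. v k * a k powr p)"
proof -
  define M where "M = (\<Sum>k=1..N. a k)"
  have M: "0 \<le> M" using a by (auto simp: M_def intro!: sum_nonneg)
  have aM: "a k \<le> M" if "1 \<le> k" "k \<le> N" for k
    unfolding M_def using that a by (intro member_le_sum) auto
  \<comment> \<open>Competitors are functions on all of \<open>nat\<close>; by Tychonoff the box is
    compact, and entries outside \<open>{1..N}\<close> are merely bounded.\<close>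
  define box where "box = PiE (UNIV :: nat set) (\<lambda>_. {0..M})"
  have "compactin (product_topology (\<lambda>_. euclidean) UNIV) box"
    unfolding box_def compactin_PiE by simp
  then have box: "compact box" by (simp add: euclidean_product_topology)
  \<comment> \<open>The absolute value keeps the energy continuous off the box, where entries may be
    negative, so that the constraint defines a closed set.\<close>
  define S where "S = box \<inter> ((\<Inter>n\<in>{..N}. {b. (\<Sum>k=1..n. d k * a k) \<le> (\<Sum>k=1..n. d k * b k)})
     \<inter> {b. (\<Sum>k=1..N. v k * \<bar>b k\<bar> powr p) \<le> (\<Sum>k=1..N. v k * a k powr p)})"
  have comp: "compact S"
    unfolding S_def using p
    by (intro compact_Int_closed box closed_Int closed_INT ballI closed_Collect_le continuous_intros
        continuous_on_powr') auto
  \<comment> \<open>The sequence \<open>a\<close> itself competes, cut off where \<open>M\<close>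
    need not bound it.\<close>
  have "(\<lambda>k. if k \<in> {1..N} then a k else 0) \<in> S"
    using a aM M by (auto simp: S_def box_def intro!: sum_mono)
  then have ne: "S \<noteq> {}" by auto
  define T where "T b = (\<Sum>n=1..N. \<Sum>k=1..n. d k * b k)" for b :: "nat \<Rightarrow> real"
  have "continuous_on S T" unfolding T_def
    by (intro continuous_intros continuous_on_product_then_coordinatewise continuous_on_id)
  then obtain b where bS: "b \<in> S" and bmax: "\<And>c. c \<in> S \<Longrightarrow> T c \<le> T b"
    using continuous_attains_sup[OF comp ne] by blast
  have b0: "0 \<le> b k" "b k \<le> M" for k using bS by (auto simp: S_def box_def)
  have bsum: "(\<Sum>k=1..n. d k * a k) \<le> (\<Sum>k=1..n. d k * b k)" if "n \<le> N" for n
    using bS that by (auto simp: S_def)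
  have bp: "(\<Sum>k=1..N. v k * b k powr p) \<le> (\<Sum>k=1..N. v k * a k powr p)"
    using bS b0 by (auto simp: S_def)
  have "b (Suc j) \<le> b j" if j: "1 \<le> j" "Suc j \<le> N" for j
  proof (rule ccontr)
    assume "\<not> b (Suc j) \<le> b j"
    then have lt: "b j < b (Suc j)" by simp
    define m where "m = (d j * b j + d (Suc j) * b (Suc j)) / (d j + d (Suc j))"
    have dp: "0 < d j" "0 < d (Suc j)" using d j by auto
    have "m * (d j + d (Suc j)) = d j * b j + d (Suc j) * b (Suc j)"
      using dp by (simp add: m_def)
    then have m3: "d j * m + d (Suc j) * m = d j * b j + d (Suc j) * b (Suc j)"
      by (simp add: algebra_simps)
    have m: "b j < m" "m < b (Suc j)"
      using dp lt by (auto simp: m_def field_simps)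
    define c where "c = b(j := m, Suc j := m)"
    have split: "(\<Sum>k=1..n. f k (c k)) = (\<Sum>k=1..n. f k (b k)) +
        ((if j \<le> n then f j m - f j (b j) else 0) +
         (if Suc j \<le> n then f (Suc j) m - f (Suc j) (b (Suc j)) else 0))" for f :: "nat \<Rightarrow> real \<Rightarrow> real" and n
    proof -
      have "(\<Sum>k=1..n. f k (c k)) - (\<Sum>k=1..n. f k (b k)) =
        (\<Sum>k=1..n. (if k = j then f j m - f j (b j) else 0) +
            (if k = Suc j then f (Suc j) m - f (Suc j) (b (Suc j)) else 0))"
        unfolding sum_subtractf[symmetric] by (intro sum.cong) (auto simp: c_def)
      also have "\<dots> = (if j \<le> n then f j m - f j (b j) else 0) +
         (if Suc j \<le> n then f (Suc j) m - f (Suc j) (b (Suc j)) else 0)"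
        using j by (simp add: sum.distrib sum.delta)
      finally show ?thesis by simp
    qed
    \<comment> \<open>Averaging with the weights \<open>d\<close> only moves mass from
      \<open>Suc j\<close> to \<open>j\<close>, so the partial sum ending at \<open>j\<close> is the
      only one that changes, and it grows.\<close>
    have csum: "(\<Sum>k=1..n. d k * c k) = (\<Sum>k=1..n. d k * b k) + (if n = j then d j * (m - b j) else 0)" for n
      using m3 by (subst split) (auto simp: algebra_simps)
    have "c \<in> S"
    proof -
      have "(\<Sum>k=1..N. v k * c k powr p) \<le> (\<Sum>k=1..N. v k * b k powr p)"
        using powr_merge[OF p dp vd[OF j(1)] _ _ b0(1) lt] v[of j] v[of "Suc j"] j
        by (subst split) (auto simp: m_def)
      moreover have "0 \<le> c k" "c k \<le> M" for k
        using b0[of k] b0[of j] b0[of "Suc j"] m by (auto simp: c_def)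
      moreover have "(\<Sum>k=1..n. d k * a k) \<le> (\<Sum>k=1..n. d k * c k)" if "n \<le> N" for n
        unfolding csum using bsum[OF that] dp m by (auto intro!: add_increasing2 mult_nonneg_nonneg)
      ultimately show ?thesis using bp by (auto simp: S_def box_def)
    qed
    moreover have "T c = T b + d j * (m - b j)"
      unfolding T_def csum using j by (simp add: sum.distrib sum.delta)
    moreover have "0 < d j * (m - b j)" using dp m by simp
    ultimately show False using bmax[of c] by linarith
  qed
  then show ?thesis by (rule that[OF b0(1) _ bsum bp])
qed

section \<open>Transport of energy along one step\<close>

text \<open>With \<open>F' = f * t powr (al - 1)\<close>, \<open>g'\<close> is the derivative of
  \<open>g\<close>, and \<open>w'\<close> is the derivative of the transported point. The estimate
  is \<open>transport_pointwise\<close> multiplied by \<open>G / w\<close>, with the quotient rule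
  for \<open>g / w\<close> read off.\<close>

lemma transport_derivative_ge:
  fixes r s al th C w F t f :: real
  assumes s: "1 < s" "s < r" and al: "s < al * r" and pos: "0 < C" "0 < F" "0 < t" "0 \<le> f"
    and w: "0 < w" "w < 1"
  defines "th \<equiv> (al * r - s) / (r - s)"
    and "g \<equiv> F powr r * t powr (s - al * r)"
    and "g' \<equiv> r * F powr (r - 1) * f * t powr (al - 1) * t powr (s - al * r)
                - (al * r - s) * F powr r * t powr (s - al * r - 1)"
    and "w' \<equiv> (s - 1) * f powr (r / s) / C / (w powr (1 / (s - 1) - 1) * (1 - w) powr ((r - 1) / (s - 1) - 1))"
  shows "(al * r - s) * F powr r * t powr (s - al * r - 1) \<le>
    th powr (s - r) * C powr (s - 1) * f powr (r / s) - (g' * w - g * w') / (w * w)"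
proof -
  define p where "p = r / s"
  have p: "1 < p" "r = p * s" using s by (auto simp: p_def field_simps)
  define G where "G = F powr r * t powr (s - al * r - 1)"
  define h where "h = f * t powr al / F"
  \<comment> \<open>Chosen so that the powers of \<open>F\<close> and \<open>t\<close> cancel in
    \<open>h powr p * G * D powr (s - 1)\<close>, while \<open>h powr p / D\<close> is free of
    \<open>F\<close>.\<close>
  define D where "D = C * F powr - p * t powr (al * p - 1)"
  have th: "0 < th" "th * (r - s) = al * r - s" using s al by (auto simp: th_def)
  have G: "0 < G" using pos by (simp add: G_def)
  have g: "g = G * t" using pos by (simp add: g_def G_def powr_diff)
  have g': "g' = G * (r * h - th * (r - s))"
    using pos unfolding th(2) by (simp add: g'_def G_def h_def powr_diff powr_add field_simps)
  have hp: "h powr p = f powr p * t powr (al * p) * F powr - p"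
    using pos by (simp add: h_def powr_mult powr_divide powr_powr powr_minus_divide)
  have D: "0 < D" using pos by (simp add: D_def)
  have Dp: "D powr (s - 1) = C powr (s - 1) * F powr (- p * (s - 1)) * t powr ((al * p - 1) * (s - 1))"
    using pos by (simp add: D_def powr_mult powr_powr)
  have "h powr p * G * D powr (s - 1) =
      f powr p * C powr (s - 1) * (F powr - p * F powr (- p * (s - 1)) * F powr r)
       * (t powr (al * p) * t powr ((al * p - 1) * (s - 1)) * t powr (s - al * r - 1))"
    unfolding hp G_def Dp by (simp only: mult_ac)
  also have "\<dots> = f powr p * C powr (s - 1) * F powr (- p + - p * (s - 1) + r)
       * t powr (al * p + (al * p - 1) * (s - 1) + (s - al * r - 1))"
    by (simp only: powr_add)
  also have "- p + - p * (s - 1) + r = 0" by (simp add: p(2) algebra_simps)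
  also have "al * p + (al * p - 1) * (s - 1) + (s - al * r - 1) = 0" by (simp add: p(2) algebra_simps)
  finally have h1: "h powr p * G * D powr (s - 1) = f powr p * C powr (s - 1)"
    using pos by simp
  have h2: "h powr p / D = f powr p * t / C"
    using pos by (simp add: hp D_def powr_diff)
  \<comment> \<open>The exponent \<open>s / (s - 1)\<close> is that of the beta density plus 2,
    which accounts for the \<open>w * w\<close> of the quotient rule.\<close>
  have wp: "w powr (s / (s - 1)) = w powr (1 / (s - 1) - 1) * (w * w)"
  proof -
    have "s / (s - 1) = (1 / (s - 1) - 1) + 2" using s by (simp add: field_simps)
    then have "w powr (s / (s - 1)) = w powr (1 / (s - 1) - 1) * w powr 2" by (simp only: powr_add)
    then show ?thesis using w by (simp add: power2_eq_square)
  qed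
  define Q where "Q = w powr (1 / (s - 1) - 1) * (1 - w) powr ((r - 1) / (s - 1) - 1)"
  have Q: "0 < Q" using w by (simp add: Q_def)
  have "r * h - th * (r - s) * (1 - w) \<le>
    h powr p * w * (th powr (s - r) * D powr (s - 1) + (s - 1) / (D * (Q * (w * w))))"
    using transport_pointwise[OF s th(1) w, of h D] pos D unfolding wp p_def Q_def
    by (simp add: h_def mult_ac)
  then have "G / w * (r * h - th * (r - s) * (1 - w)) \<le>
    G / w * (h powr p * w * (th powr (s - r) * D powr (s - 1) + (s - 1) / (D * (Q * (w * w)))))"
    using G w by (intro mult_left_mono) auto
  also have "\<dots> = th powr (s - r) * (h powr p * G * D powr (s - 1)) + G * (s - 1) * (h powr p / D) / (Q * (w * w))"
    using w D Q by (simp add: field_simps)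
  also have "\<dots> = th powr (s - r) * C powr (s - 1) * f powr p + g * w' / (w * w)"
    unfolding h1 h2 g w'_def p_def[symmetric] Q_def[symmetric] using pos by (simp add: field_simps)
  finally have "G / w * (r * h - th * (r - s) * (1 - w)) \<le>
     th powr (s - r) * C powr (s - 1) * f powr p + g * w' / (w * w)" .
  moreover have "G / w * (r * h - th * (r - s) * (1 - w)) = g' * w / (w * w) + th * (r - s) * G"
    unfolding g' using w by (simp add: field_simps)
  ultimately show ?thesis
    unfolding th(2) p_def G_def by (simp add: diff_divide_distrib mult_ac)
qed

text \<open>While the step function has the constant value \<open>f\<close>, the primitive is
  \<open>P + f / al * t powr al\<close> and the energy is affine in \<open>t\<close>. The derivative
  estimate and the lower bound \<open>qF\<close> make \<open>Phi t\<close> minus a multiple of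
  \<open>t powr s\<close> nondecreasing. Continuity is assumed in \<open>cont\<close> because the
  exponent \<open>s - al * r\<close> is negative and \<open>x0\<close> may be 0.\<close>

lemma transport_step:
  fixes r s al th C e0 f P q x0 x1 B :: real and W :: "real \<Rightarrow> real"
  assumes s: "1 < s" "s < r" and al: "0 < al" "s < al * r" and C: "0 < C"
    and F: "0 \<le> P" "0 \<le> f" "0 < P + f" and q: "0 \<le> q" and x: "0 \<le> x0" "x0 < x1"
    and W: "\<And>y. 0 < y \<Longrightarrow> y < B \<Longrightarrow> 0 < W y \<and> W y < 1"
    and dW: "\<And>y. 0 < y \<Longrightarrow> y < B \<Longrightarrow> (W has_real_derivative
        1 / (W y powr (1 / (s - 1) - 1) * (1 - W y) powr ((r - 1) / (s - 1) - 1))) (at y)"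
    and range: "\<And>t. x0 \<le> t \<Longrightarrow> t \<le> x1 \<Longrightarrow>
        0 < (s - 1) * (e0 + f powr (r / s) * t) / C \<and> (s - 1) * (e0 + f powr (r / s) * t) / C < B"
    and qF: "\<And>t. x0 < t \<Longrightarrow> t < x1 \<Longrightarrow> q * t powr al \<le> P + f / al * t powr al"
    and cont: "continuous_on {x0..x1} (\<lambda>t. (P + f / al * t powr al) powr r * t powr (s - al * r))"
  defines "Phi \<equiv> \<lambda>t. ((al * r - s) / (r - s)) powr (s - r) * C powr (s - 1) * (e0 + f powr (r / s) * t)
      - (P + f / al * t powr al) powr r * t powr (s - al * r) / W ((s - 1) * (e0 + f powr (r / s) * t) / C)"
  shows "(al * r - s) * q powr r * (x1 powr s - x0 powr s) / s \<le> Phi x1 - Phi x0"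
proof -
  define c where "c = (al * r - s) * q powr r"
  have c: "0 \<le> c" using al by (simp add: c_def)
  define y where "y = (\<lambda>t. (s - 1) * (e0 + f powr (r / s) * t) / C)"
  have Phi_y: "Phi = (\<lambda>t. ((al * r - s) / (r - s)) powr (s - r) * C powr (s - 1) * (e0 + f powr (r / s) * t)
      - (P + f / al * t powr al) powr r * t powr (s - al * r) / W (y t))"
    by (simp add: Phi_def y_def)
  have "Phi x0 - c / s * x0 powr s \<le> Phi x1 - c / s * x1 powr s"
  proof (rule DERIV_nonneg_imp_increasing_open[where f = "\<lambda>t. Phi t - c / s * t powr s"])
    fix t assume t: "x0 < t" "t < x1"
    then have t0: "0 < t" using x by simp
    define Ft where "Ft = P + f / al * t powr al"
    have Fpos: "0 < Ft"
      using F al t0 by (cases "f = 0") (auto simp: Ft_def intro!: add_nonneg_pos)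
    define w where "w = W (y t)"
    have yt: "0 < y t" "y t < B" using range[of t] t by (auto simp: y_def)
    have w: "0 < w" "w < 1" using W[OF yt] by (auto simp: w_def)
    define w' where "w' = (s - 1) * f powr (r / s) / C / (w powr (1 / (s - 1) - 1) * (1 - w) powr ((r - 1) / (s - 1) - 1))"
    define g where "g = Ft powr r * t powr (s - al * r)"
    define g' where "g' = r * Ft powr (r - 1) * f * t powr (al - 1) * t powr (s - al * r)
                - (al * r - s) * Ft powr r * t powr (s - al * r - 1)"
    have dy: "(y has_real_derivative (s - 1) * f powr (r / s) / C) (at t)"
      unfolding y_def using C by (auto intro!: derivative_eq_intros)
    have dw: "((\<lambda>t. W (y t)) has_real_derivative w') (at t)"
      using DERIV_chain2[OF dW[OF yt] dy] by (simp add: w'_def w_def mult_ac)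
    have dF: "((\<lambda>t. P + f / al * t powr al) has_real_derivative f * t powr (al - 1)) (at t)"
      using t0 al by (auto intro!: derivative_eq_intros)
    have dg: "((\<lambda>t. (P + f / al * t powr al) powr r * t powr (s - al * r)) has_real_derivative g') (at t)"
      using DERIV_mult[OF DERIV_fun_powr[OF dF, of r] has_real_derivative_powr[OF t0, of "s - al * r"]] Fpos
      unfolding g'_def Ft_def by (simp add: algebra_simps)
    have dPhi: "(Phi has_real_derivative
        ((al * r - s) / (r - s)) powr (s - r) * C powr (s - 1) * f powr (r / s)
          - (g' * w - g * w') / (w * w)) (at t)"
    proof -
      have "((\<lambda>t. ((al * r - s) / (r - s)) powr (s - r) * C powr (s - 1) * (e0 + f powr (r / s) * t))
          has_real_derivative ((al * r - s) / (r - s)) powr (s - r) * C powr (s - 1) * f powr (r / s)) (at t)"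
        by (auto intro!: derivative_eq_intros)
      from DERIV_diff[OF this DERIV_divide[OF dg dw]] w show ?thesis
        unfolding Phi_y w_def g_def Ft_def by simp
    qed
    have "c * t powr (s - 1) \<le> (al * r - s) * Ft powr r * t powr (s - al * r - 1)"
    proof -
      have "(q * t powr al) powr r \<le> Ft powr r"
        using qF[OF t] q s by (intro powr_mono2) (auto simp: Ft_def)
      then have "q powr r * t powr (al * r) * t powr (s - al * r - 1) \<le> Ft powr r * t powr (s - al * r - 1)"
        using q by (intro mult_right_mono) (auto simp: powr_mult powr_powr)
      moreover have "t powr (al * r) * t powr (s - al * r - 1) = t powr (s - 1)"
        by (simp add: powr_add[symmetric])
      ultimately have "q powr r * t powr (s - 1) \<le> Ft powr r * t powr (s - al * r - 1)"
        by (simp add: mult.assoc)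
      then show ?thesis
        using al unfolding c_def mult.assoc by (intro mult_left_mono) auto
    qed
    also have "\<dots> \<le> ((al * r - s) / (r - s)) powr (s - r) * C powr (s - 1) * f powr (r / s)
          - (g' * w - g * w') / (w * w)"
      unfolding g'_def g_def w'_def
      by (rule transport_derivative_ge[OF s al(2) C Fpos t0 F(2) w])
    finally have "0 \<le> ((al * r - s) / (r - s)) powr (s - r) * C powr (s - 1) * f powr (r / s)
          - (g' * w - g * w') / (w * w) - c * t powr (s - 1)" by simp
    moreover have "((\<lambda>t. Phi t - c / s * t powr s) has_real_derivative
       ((al * r - s) / (r - s)) powr (s - r) * C powr (s - 1) * f powr (r / s)
          - (g' * w - g * w') / (w * w) - c * t powr (s - 1)) (at t)"
      using t0 s by (auto intro!: derivative_eq_intros dPhi)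
    ultimately show "\<exists>d. ((\<lambda>t. Phi t - c / s * t powr s) has_real_derivative d) (at t) \<and> 0 \<le> d"
      by blast
  next
    have cy: "continuous_on {x0..x1} y" unfolding y_def using C by (intro continuous_intros) auto
    have "continuous_on {0<..<B} W"
      using DERIV_isCont[OF dW] by (intro continuous_at_imp_continuous_on) auto
    then have "continuous_on {x0..x1} (\<lambda>t. W (y t))"
      using range by (intro continuous_on_compose2[OF _ cy]) (auto simp: y_def)
    moreover have "W (y t) \<noteq> 0" if "t \<in> {x0..x1}" for t
      using W[of "y t"] range[of t] that by (auto simp: y_def)
    moreover have "continuous_on {x0..x1} (\<lambda>t. c / s * t powr s)"
      using x s by (intro continuous_on_mult continuous_on_const continuous_on_powr' continuous_on_id) auto
    moreover have "continuous_on {x0..x1}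
        (\<lambda>t. ((al * r - s) / (r - s)) powr (s - r) * C powr (s - 1) * (e0 + f powr (r / s) * t))"
      by (intro continuous_on_mult continuous_on_add continuous_on_const continuous_on_id)
    ultimately show "continuous_on {x0..x1} (\<lambda>t. Phi t - c / s * t powr s)"
      unfolding Phi_y by (intro continuous_on_diff continuous_on_divide cont) auto
  qed (use x in simp)
  then show ?thesis
    unfolding c_def[symmetric] by (simp add: right_diff_distrib diff_divide_distrib)
qed

section \<open>Summation tools and the Bliss inequality for decreasing steps\<close>

lemma abel_sum_le:
  fixes w g S :: "nat \<Rightarrow> real"
  assumes S0: "S 0 = 0" and wS: "\<And>m. 1 \<le> m \<Longrightarrow> (\<Sum>n=1..m. w n) \<le> S m"
    and g: "\<And>n. 1 \<le> n \<Longrightarrow> n \<le> N \<Longrightarrow> 0 \<le> g n"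
    and mono: "\<And>n. 1 \<le> n \<Longrightarrow> Suc n \<le> N \<Longrightarrow> g (Suc n) \<le> g n"
  shows "(\<Sum>n=1..N. w n * g n) \<le> (\<Sum>n=1..N. (S n - S (n - 1)) * g n)"
proof (cases "N = 0")
  case False
  \<comment> \<open>The slack between \<open>S m\<close> and the partial sum of \<open>w\<close> is
    carried along, weighted by \<open>g m\<close>; since \<open>g\<close> decreases, its weight only
    shrinks when \<open>m\<close> advances.\<close>
  have "(\<Sum>n=1..m. w n * g n) + (S m - (\<Sum>n=1..m. w n)) * g m \<le> (\<Sum>n=1..m. (S n - S (n - 1)) * g n)"
    if "1 \<le> m" "m \<le> N" for m
    using that
  proof (induction m rule: dec_induct)
    case base
    show ?case using S0 by (simp add: algebra_simps)
  next
    case (step m)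
    have "(S m - (\<Sum>n=1..m. w n)) * g (Suc m) \<le> (S m - (\<Sum>n=1..m. w n)) * g m"
      using step wS mono[of m] by (intro mult_left_mono) auto
    then show ?case using step by (simp add: algebra_simps)
  qed
  from this[of N] have "(\<Sum>n=1..N. w n * g n) + (S N - (\<Sum>n=1..N. w n)) * g N \<le> (\<Sum>n=1..N. (S n - S (n - 1)) * g n)"
    using False by simp
  moreover have "0 \<le> (S N - (\<Sum>n=1..N. w n)) * g N"
    using wS[of N] g[of N] False by simp
  ultimately show ?thesis by linarith
qed simp

lemma sum_diff_pred:
  fixes f :: "nat \<Rightarrow> real"
  shows "(\<Sum>n=1..N. f n - f (n - 1)) = f N - f 0"
  by (induction N) auto

text \<open>Turns the coefficient produced by the transport argument into the constant of the
  theorem. The base \<open>1 + (al - 1) * (r / (r - s))\<close> is \<open>th\<close>, and since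
  \<open>1 / (s - 1) + (r - 1) / (s - 1) = r / (s - 1)\<close>, the Gamma quotient is
  \<open>(s - 1) / b\<close>.\<close>

lemma bliss_const_eq:
  fixes r s al S C :: real
  assumes s: "1 < s" "s < r" and al: "s < al * r" and S: "0 < S"
  defines "b \<equiv> Beta (1 / (s - 1)) ((r - 1) / (s - 1))"
  shows "((al * r - s) / (r - s)) powr (s - r) * ((s - 1) * S / b) powr (s - 1) * S =
     (al * r - s) * (bliss_const r s al * S powr s)"
proof -
  define th where "th = (al * r - s) / (r - s)"
  have th: "0 < th" "al * r - s = th * (r - s)" "1 + (al - 1) * (r / (r - s)) = th"
    using s al by (auto simp: th_def field_simps)
  have b: "0 < b" unfolding b_def Beta_def using s by (intro divide_pos_pos mult_pos_pos Gamma_real_pos) (auto intro!: add_pos_pos)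
  have "1 / (s - 1) + (r - 1) / (s - 1) = r / (s - 1)" by (simp add: add_divide_distrib[symmetric])
  then have "(s - 1) * Gamma (r / (s - 1)) / (Gamma (1 / (s - 1)) * Gamma ((r - 1) / (s - 1))) = (s - 1) / b"
    by (simp add: b_def Beta_def)
  then have "bliss_const r s al = 1 / ((r - s) * th powr (r - s + 1)) * ((s - 1) / b) powr (s - 1)"
    unfolding bliss_const_def th(3) by simp
  moreover have "((s - 1) * S / b) powr (s - 1) * S = ((s - 1) / b) powr (s - 1) * S powr s"
    using S b s by (simp add: powr_mult powr_divide powr_diff)
  moreover have "th powr (s - r) = th * (r - s) * (1 / ((r - s) * th powr (r - s + 1)))"
    using th(1) s by (simp add: powr_add powr_diff)
  ultimately show ?thesis unfolding th(2) th_def[symmetric] by simp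
qed

text \<open>An average of a decreasing sequence is at least the next entry. This gives
  \<open>P\<close> its sign in the transport step and makes the averages decrease.\<close>

lemma antimono_mult_le_weighted_sum:
  fixes b D :: "nat \<Rightarrow> real"
  assumes D0: "D 0 = 0" and D: "\<And>k. 1 \<le> k \<Longrightarrow> D (k - 1) < D k"
    and mono: "\<And>k. 1 \<le> k \<Longrightarrow> Suc k \<le> N \<Longrightarrow> b (Suc k) \<le> b k"
    and n: "Suc n \<le> N"
  shows "b (Suc n) * D n \<le> (\<Sum>k=1..n. (D k - D (k - 1)) * b k)"
  using n
proof (induction n)
  case 0
  then show ?case using D0 by simp
next
  case (Suc n)
  have "0 \<le> D (Suc n)"
  proof -
    have "0 \<le> D m" for m
    proof (induction m)
      case (Suc m)
      then show ?case using D[of "Suc m"] by simp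
    qed (simp add: D0)
    then show ?thesis .
  qed
  then have "b (Suc (Suc n)) * D (Suc n) \<le> b (Suc n) * D (Suc n)"
    using mono[of "Suc n"] Suc.prems by (intro mult_right_mono) auto
  also have "\<dots> \<le> (\<Sum>k=1..Suc n. (D k - D (k - 1)) * b k)"
    using Suc by (simp add: algebra_simps)
  finally show ?case .
qed

text \<open>Between consecutive breakpoints the potential \<open>Psi\<close> grows by at least a
  fixed multiple of the corresponding summand, and these increments telescope. The strict bound by
  \<open>S\<close> leaves room for \<open>eps\<close>.\<close>

lemma bliss_decreasing_steps:
  fixes r s al S :: real and v b V :: "nat \<Rightarrow> real" and N :: nat
  assumes s: "1 < s" "s < r" and al: "0 < al" "s < al * r" and N: "1 \<le> N"
    and v: "\<And>k. 1 \<le> k \<Longrightarrow> 0 < v k" and V: "\<And>n. V n = (\<Sum>k=1..n. v k)"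
    and b: "\<And>k. 0 \<le> b k" "0 < b 1" and mono: "\<And>k. 1 \<le> k \<Longrightarrow> Suc k \<le> N \<Longrightarrow> b (Suc k) \<le> b k"
    and S: "(\<Sum>k=1..N. v k * b k powr (r / s)) < S"
  shows "(\<Sum>n=1..N. (V n powr s - V (n - 1) powr s) *
      ((\<Sum>k=1..n. (V k powr al - V (k - 1) powr al) * b k) / V n powr al) powr r)
    \<le> s * al powr r * bliss_const r s al * S powr s"
proof -
  define p where "p = r / s"
  define be where "be = Beta (1 / (s - 1)) ((r - 1) / (s - 1))"
  have be: "0 < be"
    unfolding be_def Beta_def using s
    by (intro divide_pos_pos mult_pos_pos Gamma_real_pos) (auto intro!: add_pos_pos)
  have ab: "0 < 1 / (s - 1)" "0 < (r - 1) / (s - 1)" using s by auto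
  obtain W where W: "\<And>y. 0 < y \<Longrightarrow> y < be \<Longrightarrow> 0 < W y \<and> W y < 1"
    and dW: "\<And>y. 0 < y \<Longrightarrow> y < be \<Longrightarrow> (W has_real_derivative
        1 / (W y powr (1 / (s - 1) - 1) * (1 - W y) powr ((r - 1) / (s - 1) - 1))) (at y)"
    using incomplete_beta_inverse[OF ab, folded be_def] by blast
  define E where "E n = (\<Sum>k=1..n. v k * b k powr p)" for n
  \<comment> \<open>Starting from energy \<open>eps\<close> instead of \<open>0\<close> keeps \<open>W\<close> away from \<open>0\<close> at the origin.\<close>
  define eps where "eps = (S - E N) / 2"
  have eps: "0 < eps" "eps + E N < S" 
  proof -
    have "E N < S" using S by (simp add: E_def p_def)
    then show "0 < eps" "eps + E N < S" by (auto simp: eps_def field_simps)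
  qed
  have E0: "0 \<le> E n" for n unfolding E_def using v by (intro sum_nonneg) (simp add: less_imp_le)
  have Emono: "E n \<le> E N" if "n \<le> N" for n
    unfolding E_def using that v by (intro sum_mono2) (auto simp: less_imp_le)
  have Spos: "0 < S" using eps E0[of N] by simp
  \<comment> \<open>With this scale the argument of \<open>W\<close> would reach \<open>be\<close>
    exactly at energy \<open>S\<close>; all energies below stay strictly smaller.\<close>
  define C where "C = (s - 1) * S / be"
  have C: "0 < C" using s Spos be by (simp add: C_def)
  define D where "D n = V n powr al" for n
  define Bs where "Bs n = (\<Sum>k=1..n. (D k - D (k - 1)) * b k)" for n
  have V0: "V 0 = 0" and VS: "V (Suc n) = V n + v (Suc n)" for n by (auto simp: V)
  have Vn: "0 \<le> V n" for n unfolding V using v by (intro sum_nonneg) (simp add: less_imp_le)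
  have Vmono: "V n < V (Suc n)" for n using v VS by simp
  have Vpos: "0 < V (Suc n)" for n using Vmono[of n] Vn[of n] by linarith
  have D0: "D 0 = 0" by (simp add: D_def V0)
  have Dpos: "0 < D (Suc n)" for n using Vpos[of n] by (simp add: D_def)
  have Dmono: "D n < D (Suc n)" for n using Vmono Vn al by (simp add: D_def powr_less_mono2)
  have BS: "Bs (Suc n) = Bs n + (D (Suc n) - D n) * b (Suc n)" for n by (simp add: Bs_def)
  have Bs0: "Bs 0 = 0" by (simp add: Bs_def)
  have Bn: "0 \<le> Bs n" for n
    by (induction n) (use BS Bs0 Dmono b in \<open>auto intro!: add_nonneg_nonneg mult_nonneg_nonneg simp: less_imp_le\<close>)
  have Bpos: "0 < Bs (Suc n)" for n
    by (induction n) (use BS Bs0 Dmono[of 0] D0 Dmono b in \<open>auto intro!: add_pos_nonneg mult_nonneg_nonneg simp: less_imp_le\<close>)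
  have bD: "b (Suc n) * D n \<le> Bs n" if "Suc n \<le> N" for n
    unfolding Bs_def
  proof (rule antimono_mult_le_weighted_sum[of D N])
    show "D (k - 1) < D k" if "1 \<le> k" for k using Dmono[of "k - 1"] that by simp
  qed (use D0 mono that in auto)
  define A where "A = ((al * r - s) / (r - s)) powr (s - r) * C powr (s - 1)"
  define Psi where "Psi n = A * (eps + E n) -
     (Bs n / al) powr r * V n powr (s - al * r) / W ((s - 1) * (eps + E n) / C)" for n
  have step: "(al * r - s) * (Bs (Suc n) / D (Suc n) / al) powr r * (V (Suc n) powr s - V n powr s) / s
      \<le> Psi (Suc n) - Psi n" if n: "Suc n \<le> N" for n
  proof -
    define f where "f = b (Suc n)"
    \<comment> \<open>\<open>P\<close> and \<open>e0\<close> are the primitive and the energy of the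
      current step extrapolated to \<open>t = 0\<close>; \<open>q\<close> is the primitive divided
      by \<open>t powr al\<close> at the right end.\<close>
    define P where "P = (Bs n - f * D n) / al"
    define e0 where "e0 = eps + E n - f powr p * V n"
    define q where "q = Bs (Suc n) / D (Suc n) / al"
    have f: "0 \<le> f" using b by (simp add: f_def)
    have P: "0 \<le> P" using bD[OF n] al by (simp add: P_def f_def)
    \<comment> \<open>If \<open>f = 0\<close>, then \<open>n\<close> is not 0 because
      \<open>b 1\<close> is positive, and the earlier steps contribute.\<close>
    have Pf: "0 < P + f"
    proof (cases "f = 0")
      case True
      then obtain m where "n = Suc m" using b(2) by (cases n) (auto simp: f_def)
      then show ?thesis using True Bpos al by (simp add: P_def)
    qed (use P f in simp)
    have F0: "P + f / al * V n powr al = Bs n / al"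
      using al by (simp add: P_def D_def field_simps)
    have F1: "P + f / al * V (Suc n) powr al = Bs (Suc n) / al"
      using al unfolding BS by (simp add: P_def D_def f_def field_simps)
    have E0': "e0 + f powr p * V n = eps + E n" by (simp add: e0_def)
    have E1: "e0 + f powr p * V (Suc n) = eps + E (Suc n)"
      unfolding VS by (simp add: e0_def E_def f_def algebra_simps)
    have range: "0 < (s - 1) * (e0 + f powr p * t) / C \<and> (s - 1) * (e0 + f powr p * t) / C < be"
      if "V n \<le> t" "t \<le> V (Suc n)" for t
    proof -
      have "f powr p * V n \<le> f powr p * t" "f powr p * t \<le> f powr p * V (Suc n)"
        using that by (auto intro!: mult_left_mono)
      then have "0 < e0 + f powr p * t" "e0 + f powr p * t < S"
        using E0' E1 eps E0[of n] Emono[OF n] by linarith+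
      moreover have eq: "(s - 1) * (e0 + f powr p * t) / C = be * (e0 + f powr p * t) / S"
        using s by (simp add: C_def)
      ultimately show ?thesis unfolding eq using be Spos by (simp add: pos_divide_less_eq)
    qed
    have q: "0 \<le> q" using Bn al Dpos[of n] by (simp add: q_def)
    \<comment> \<open>The primitive over \<open>t powr al\<close> is
      \<open>P / t powr al + f / al\<close>, nonincreasing as \<open>P\<close> is nonnegative, so
      its value \<open>q\<close> at the right end is the least.\<close>
    have qF: "q * t powr al \<le> P + f / al * t powr al" if "V n < t" "t < V (Suc n)" for t
    proof -
      have "t powr al \<le> D (Suc n)"
        unfolding D_def using that Vn[of n] al by (intro powr_mono2) auto
      then have "P * t powr al \<le> P * D (Suc n)" using P by (rule mult_left_mono)
      then have "P * t powr al / D (Suc n) \<le> P" using Dpos[of n] by (simp add: field_simps)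
      moreover have "q = P / D (Suc n) + f / al"
        using F1 Dpos[of n] by (simp add: q_def D_def[symmetric] field_simps)
      ultimately show ?thesis by (simp add: algebra_simps)
    qed
    \<comment> \<open>On the first interval \<open>P = 0\<close> turns the product into a multiple
      of \<open>t powr s\<close>, continuous at 0 as well; on later intervals \<open>t\<close> is
      positive.\<close>
    have cont: "continuous_on {V n..V (Suc n)} (\<lambda>t. (P + f / al * t powr al) powr r * t powr (s - al * r))"
    proof (cases n)
      case 0
      have "(\<lambda>t. (f / al) powr r * t powr s) t = (P + f / al * t powr al) powr r * t powr (s - al * r)"
        if "t \<in> {V n..V (Suc n)}" for t
      proof -
        have "P = 0" "0 \<le> t" using that by (auto simp: 0 P_def Bs0 D0 V0)
        then show ?thesis using f al
          by (simp add: powr_mult powr_powr powr_add[symmetric] powr_divide)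
      qed
      moreover have "continuous_on {V n..V (Suc n)} (\<lambda>t. (f / al) powr r * t powr s)"
        using s by (intro continuous_on_mult continuous_on_const continuous_on_powr' continuous_on_id)
          (auto simp: 0 V0)
      ultimately show ?thesis by (rule continuous_on_cong[THEN iffD1, OF refl])
    next
      case (Suc m)
      have t: "0 < t" if "t \<in> {V n..V (Suc n)}" for t
        using that Vpos[of m] Suc by auto
      have "P + f / al * t powr al \<noteq> 0" if "t \<in> {V n..V (Suc n)}" for t
      proof (cases "f = 0")
        case False
        then have "0 < f / al * t powr al" using f al t[OF that] by simp
        then show ?thesis using P by simp
      qed (use Pf in simp)
      then show ?thesis
        by (intro continuous_on_mult continuous_on_add continuous_on_const continuous_on_powr continuous_on_id)
          (use t[of 0] in auto)
    qed
    show ?thesis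
      using transport_step[OF s al C P f Pf q Vn[of n] Vmono[of n] W dW range[unfolded p_def] qF cont]
      unfolding p_def[symmetric] F0 F1 E0' E1 Psi_def A_def q_def .
  qed
  define X where "X = (\<Sum>n=1..N. (V n powr s - V (n - 1) powr s) * (Bs n / D n) powr r)"
  have "(al * r - s) / (s * al powr r) * X =
      (\<Sum>n=1..N. (al * r - s) * (Bs n / D n / al) powr r * (V n powr s - V (n - 1) powr s) / s)"
    unfolding X_def sum_distrib_left
    using al Bn by (intro sum.cong) (auto simp: powr_divide powr_mult D_def mult_ac)
  also have "\<dots> \<le> (\<Sum>n=1..N. Psi n - Psi (n - 1))"
  proof (rule sum_mono)
    fix n assume "n \<in> {1..N}"
    then show "(al * r - s) * (Bs n / D n / al) powr r * (V n powr s - V (n - 1) powr s) / s \<le> Psi n - Psi (n - 1)"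
      using step[of "n - 1"] by simp
  qed
  also have "\<dots> = Psi N - Psi 0" by (rule sum_diff_pred)
  \<comment> \<open>In \<open>Psi N\<close> the subtracted term is nonnegative; in
    \<open>Psi 0\<close> it vanishes because \<open>Bs 0 = 0\<close>.\<close>
  also have "\<dots> \<le> A * S"
  proof -
    have eq: "(s - 1) * (eps + E N) / C = be * (eps + E N) / S"
      using s by (simp add: C_def)
    have "0 < (s - 1) * (eps + E N) / C" "(s - 1) * (eps + E N) / C < be"
      unfolding eq using be Spos eps E0[of N] by (simp_all add: pos_divide_less_eq add_pos_nonneg)
    then have "0 < W ((s - 1) * (eps + E N) / C)" using W by blast
    then have "Psi N \<le> A * (eps + E N)" by (simp add: Psi_def)
    also have "\<dots> \<le> A * S" using eps by (intro mult_left_mono) (auto simp: A_def)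
    finally have "Psi N \<le> A * S" .
    moreover have "0 \<le> Psi 0" using eps by (simp add: Psi_def A_def Bs0 E_def)
    ultimately show ?thesis by simp
  qed
  also have "A * S = (al * r - s) * (bliss_const r s al * S powr s)"
    unfolding A_def C_def be_def by (rule bliss_const_eq[OF s al(2) Spos])
  finally have "(al * r - s) * (X / (s * al powr r)) \<le> (al * r - s) * (bliss_const r s al * S powr s)"
    by simp
  then have "X / (s * al powr r) \<le> bliss_const r s al * S powr s"
    by (rule mult_left_le_imp_le) (use al in simp)
  then show ?thesis
    using s al unfolding X_def Bs_def D_def by (simp add: field_simps)
qed

section \<open>Reduction of arbitrary sequences to decreasing ones\<close>

text \<open>By the mean value theorem each ratio is \<open>1 / (al * c powr (al - 1))\<close> at an
  intermediate point, which increases with \<open>c\<close> as \<open>al \<le> 1\<close>. This is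
  the ratio condition under which averaging does not enlarge the energy.\<close>

lemma powr_increment_ratio_mono:
  fixes x y z al :: real
  assumes al: "0 < al" "al \<le> 1" and xyz: "0 \<le> x" "x < y" "y < z"
  shows "(y - x) / (y powr al - x powr al) \<le> (z - y) / (z powr al - y powr al)"
proof -
  have mvt: "\<exists>c>a. c < b \<and> b powr al - a powr al = (b - a) * (al * c powr (al - 1))"
    if ab: "0 \<le> a" "a < b" for a b
  proof -
    have der: "((\<lambda>t. t powr al) has_real_derivative al * c powr (al - 1)) (at c)" if "a < c" for c
      using that ab by (intro has_real_derivative_powr) simp
    \<comment> \<open>At \<open>a = 0\<close> the power is continuous but need not be
      differentiable, so only interior derivatives are used.\<close>
    have "continuous_on {a..b} (\<lambda>t. t powr al)"
      using ab al by (intro continuous_on_powr' continuous_on_const continuous_on_id) auto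
    moreover have "(\<lambda>t. t powr al) differentiable (at c)" if "a < c" for c
      using der[OF that] real_differentiable_def by blast
    ultimately obtain l c where "a < c" "c < b" "((\<lambda>t. t powr al) has_real_derivative l) (at c)"
      "b powr al - a powr al = (b - a) * l"
      using MVT[of a b "\<lambda>t. t powr al"] ab by blast
    then show ?thesis using DERIV_unique[OF der] by blast
  qed
  obtain c where c: "x < c" "c < y" "y powr al - x powr al = (y - x) * (al * c powr (al - 1))"
    using mvt[of x y] xyz by auto
  obtain d where d: "y < d" "d < z" "z powr al - y powr al = (z - y) * (al * d powr (al - 1))"
    using mvt[of y z] xyz by auto
  have "d powr (al - 1) \<le> c powr (al - 1)"
    using al c d xyz by (intro powr_mono2') auto
  then have "1 / (al * c powr (al - 1)) \<le> 1 / (al * d powr (al - 1))"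
    using al c d xyz by (intro divide_left_mono mult_left_mono mult_pos_pos) auto
  then show ?thesis
    unfolding c(3) d(3) using xyz by simp
qed

lemma finite_bliss_inequality:
  fixes r s al S :: real and u v a V :: "nat \<Rightarrow> real" and N :: nat
  assumes s: "1 < s" "s < r" and al: "0 < al" "al \<le> 1" "s < al * r" and N: "1 \<le> N"
    and u: "\<And>n. 1 \<le> n \<Longrightarrow> 0 < u n" and v: "\<And>n. 1 \<le> n \<Longrightarrow> 0 < v n" and a: "\<And>n. 1 \<le> n \<Longrightarrow> 0 < a n"
    and V: "\<And>n. V n = (\<Sum>k=1..n. v k)"
    and uV: "\<And>m. 1 \<le> m \<Longrightarrow> (\<Sum>n=1..m. u n * V n powr (al * r)) \<le> V m powr s"
    and S: "(\<Sum>k=1..N. v k * a k powr (r / s)) < S"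
  shows "(\<Sum>n=1..N. u n * (\<Sum>k=1..n. (V k powr al - V (k - 1) powr al) * a k) powr r)
    \<le> s * al powr r * bliss_const r s al * S powr s"
proof -
  define d where "d k = V k powr al - V (k - 1) powr al" for k
  have V0: "V 0 = 0" and VS: "V (Suc n) = V n + v (Suc n)" for n by (auto simp: V)
  have Vn: "0 \<le> V n" for n unfolding V using v by (intro sum_nonneg) (simp add: less_imp_le)
  have Vm: "V (k - 1) < V k" if "1 \<le> k" for k using v[of k] VS[of "k - 1"] that by simp
  have Vpos: "0 < V k" if "1 \<le> k" for k using Vm[OF that] Vn[of "k - 1"] by linarith
  have d: "0 < d k" if "1 \<le> k" for k
    using Vm[OF that] Vn[of "k - 1"] al by (simp add: d_def powr_less_mono2)
  have vd: "v k / d k \<le> v (Suc k) / d (Suc k)" if "1 \<le> k" for k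
    using powr_increment_ratio_mono[OF al(1,2) Vn[of "k - 1"] Vm[OF that] Vm[of "Suc k", simplified]]
      VS[of k] VS[of "k - 1"] that by (simp add: d_def)
  obtain b where b0: "\<And>k. 0 \<le> b k" and mono: "\<And>k. 1 \<le> k \<Longrightarrow> Suc k \<le> N \<Longrightarrow> b (Suc k) \<le> b k"
    and ab: "\<And>n. n \<le> N \<Longrightarrow> (\<Sum>k=1..n. d k * a k) \<le> (\<Sum>k=1..n. d k * b k)"
    and bp: "(\<Sum>k=1..N. v k * b k powr (r / s)) \<le> (\<Sum>k=1..N. v k * a k powr (r / s))"
    using level_sequence[of "r / s" d v a N] s d v vd a by (auto simp: less_imp_le)
  \<comment> \<open>The first partial sum does not shrink, so the first entry stays positive, as the
    transport argument requires.\<close>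
  have b1: "0 < b 1"
  proof -
    have "0 < d 1 * a 1" using d a by simp
    also have "\<dots> \<le> d 1 * b 1" using ab[of 1] N by simp
    finally show ?thesis using d[of 1] by (simp add: zero_less_mult_iff)
  qed
  define B where "B n = (\<Sum>k=1..n. d k * b k)" for n
  have B: "0 \<le> B n" for n
    unfolding B_def using d b0 by (intro sum_nonneg mult_nonneg_nonneg) (auto simp: less_imp_le)
  define g where "g n = (B n / V n powr al) powr r" for n
  have gmono: "g (Suc n) \<le> g n" if n: "1 \<le> n" "Suc n \<le> N" for n
  proof -
    have bV: "b (Suc n) * V n powr al \<le> B n"
      unfolding B_def d_def
    proof (rule antimono_mult_le_weighted_sum[of "\<lambda>n. V n powr al" N])
      show "V (k - 1) powr al < V k powr al" if "1 \<le> k" for k using d[OF that] by (simp add: d_def)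
    qed (use V0 mono n in auto)
    have "0 \<le> (B n - b (Suc n) * V n powr al) * (V (Suc n) powr al - V n powr al)"
      using bV d[of "Suc n"] by (intro mult_nonneg_nonneg) (auto simp: d_def)
    moreover have BS: "B (Suc n) = B n + (V (Suc n) powr al - V n powr al) * b (Suc n)"
      by (simp add: B_def d_def)
    ultimately have "B (Suc n) * V n powr al \<le> B n * V (Suc n) powr al"
      unfolding BS by (simp add: algebra_simps)
    then have "B (Suc n) / V (Suc n) powr al \<le> B n / V n powr al"
      using Vpos[of n] Vpos[of "Suc n"] n by (simp add: field_simps)
    then show ?thesis
      unfolding g_def using B s by (intro powr_mono2) auto
  qed
  have "(\<Sum>n=1..N. u n * (\<Sum>k=1..n. d k * a k) powr r) \<le> (\<Sum>n=1..N. u n * V n powr (al * r) * g n)"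
  proof (rule sum_mono)
    fix n assume n: "n \<in> {1..N}"
    have "(\<Sum>k=1..n. d k * a k) powr r \<le> B n powr r"
      unfolding B_def using n ab s d a
      by (intro powr_mono2 sum_nonneg mult_nonneg_nonneg) (auto simp: less_imp_le)
    then have "u n * (\<Sum>k=1..n. d k * a k) powr r \<le> u n * B n powr r"
      using u[of n] n by (intro mult_left_mono) auto
    also have "B n powr r = V n powr (al * r) * g n"
      using Vpos[of n] n B by (simp add: g_def powr_divide powr_powr)
    finally show "u n * (\<Sum>k=1..n. d k * a k) powr r \<le> u n * V n powr (al * r) * g n"
      by (simp add: mult.assoc)
  qed
  also have "\<dots> \<le> (\<Sum>n=1..N. (V n powr s - V (n - 1) powr s) * g n)"
    by (rule abel_sum_le) (use uV gmono V0 s in \<open>auto simp: g_def\<close>)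
  also have "\<dots> \<le> s * al powr r * bliss_const r s al * S powr s"
    unfolding g_def B_def d_def
    by (rule bliss_decreasing_steps[OF s al(1,3) N v V b0 b1 mono]) (use S bp in auto)
  finally show ?thesis unfolding d_def .
qed

section \<open>Passage to infinite sums\<close>

theorem theorem3p2:
  fixes r s \<alpha> :: real and u v a V :: "nat \<Rightarrow> real"
  assumes "1 < s" and "s < r"
    and "s / r < \<alpha>" and "\<alpha> \<le> 1"
    and u_pos: "\<And>n. n \<ge> 1 \<Longrightarrow> u n > 0"
    and v_pos: "\<And>n. n \<ge> 1 \<Longrightarrow> v n > 0"
    and a_pos: "\<And>n. n \<ge> 1 \<Longrightarrow> a n > 0"
    and V_eq: "\<And>n. V n = (\<Sum>k=1..n. v k)"
    and uV_le: "\<And>m. m \<ge> 1 \<Longrightarrow> (\<Sum>n=1..m. u n * V n powr (\<alpha> * r)) \<le> V m powr s"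
    and rhs_summable: "summable (\<lambda>n. v (Suc n) * a (Suc n) powr (r / s))"
  shows "summable (\<lambda>n. u (Suc n) *
             (\<Sum>k=1..Suc n. (V k powr \<alpha> - V (k - 1) powr \<alpha>) * a k) powr r) \<and>
         (\<Sum>n. u (Suc n) *
             (\<Sum>k=1..Suc n. (V k powr \<alpha> - V (k - 1) powr \<alpha>) * a k) powr r)
         \<le> s * \<alpha> powr r * bliss_const r s \<alpha> *
             (\<Sum>n. v (Suc n) * a (Suc n) powr (r / s)) powr s"
proof -
  define x where "x n = u n * (\<Sum>k=1..n. (V k powr \<alpha> - V (k - 1) powr \<alpha>) * a k) powr r" for n
  define T where "T = (\<Sum>n. v (Suc n) * a (Suc n) powr (r / s))"
  define c where "c = s * \<alpha> powr r * bliss_const r s \<alpha>"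
  have al: "0 < \<alpha>" "s < \<alpha> * r"
    using assms(1-3) by (auto simp: field_simps intro: less_trans[of 0 "s / r"])
  have x0: "0 \<le> x (Suc n)" for n using u_pos[of "Suc n"] by (simp add: x_def)
  have T0: "0 < T"
    unfolding T_def
  proof (rule suminf_pos[OF rhs_summable])
    show "0 < v (Suc n) * a (Suc n) powr (r / s)" for n
      using v_pos[of "Suc n"] a_pos[of "Suc n"] by simp
  qed
  have part: "(\<Sum>k=1..n. v k * a k powr (r / s)) \<le> T" for n
    unfolding T_def One_nat_def sum.atLeast1_atMost_eq using v_pos
    by (intro sum_le_suminf rhs_summable) (auto simp: less_imp_le)
  \<comment> \<open>The finite inequality needs \<open>S\<close> strictly above the energy, so the
    bound at \<open>T\<close> is the limit as \<open>S\<close> decreases to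
    \<open>T\<close>.\<close>
  have bound': "(\<Sum>n=1..N. x n) \<le> c * T powr s" if N: "1 \<le> N" for N
  proof (rule tendsto_lowerbound)
    show "((\<lambda>S. c * S powr s) \<longlongrightarrow> c * T powr s) (at_right T)"
      using T0 by (auto intro!: tendsto_intros)
    show "\<forall>\<^sub>F S in at_right T. (\<Sum>n=1..N. x n) \<le> c * S powr s"
      unfolding eventually_at_right_field c_def x_def
      using finite_bliss_inequality[OF assms(1,2) al(1) assms(4) al(2) N u_pos v_pos a_pos V_eq uV_le]
        part[of N] by (intro exI[of _ "T + 1"]) force
  qed simp
  have bound: "(\<Sum>n<N. x (Suc n)) \<le> c * T powr s" for N
  proof -
    have "(\<Sum>n<N. x (Suc n)) \<le> (\<Sum>n<Suc N. x (Suc n))" using x0 by simp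
    also have "\<dots> \<le> c * T powr s"
      using bound'[of "Suc N"] by (simp only: One_nat_def sum.atLeast1_atMost_eq)
    finally show ?thesis .
  qed
  have "summable (\<lambda>n. x (Suc n))"
    by (rule summableI_nonneg_bounded[OF x0 bound])
  moreover from this have "(\<Sum>n. x (Suc n)) \<le> c * T powr s"
    by (rule suminf_le_const) (rule bound)
  ultimately show ?thesis unfolding x_def T_def c_def by simp
qed

end
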